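(* Let $G$ be a nondiscrete locally compact abelian topological group in which every open subgroup has index at most $\mathrm{cof}(\mathcal{N})$. Then $G$ is nice; that is, there exists a compact set $C\subset G$ of Haar measure zero such that $G$ can be covered by $\mathrm{cof}(\mathcal{N})$ many translates of $C$.
   Context: All topological groups are assumed to be Hausdorff. $\mathcal{N}$ denotes the family of Lebesgue null subsets of the real line $\mathbb{R}$, and $\mathrm{cof}(\mathcal{N})=\min\{|\mathcal{H}| : \mathcal{H}\subset\mathcal{N},\ \forall N\in\mathcal{N}\ \exists H\in\mathcal{H}\ N\subset H\}$. A locally compact group $G$ is called nice if there exists a compact set $C\subset G$ of Haar measure zero such that $G$ can be covered by $\mathrm{cof}(\mathcal{N})$ many left translates of $C$, i.e. $G=\bigcup_{a\in A} aC$ for some $A\subset G$ with $|A|\le\mathrm{cof}(\mathcal{N})$. *)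

theory Defs
  imports "HOL-Analysis.Analysis"
begin

unbundle cardinal_syntax

definition cofinal_null :: "real set set \<Rightarrow> bool" where
  "cofinal_null \<H> \<longleftrightarrow>
     \<H> \<subseteq> null_sets lebesgue \<and> (\<forall>N \<in> null_sets lebesgue. \<exists>H \<in> \<H>. N \<subseteq> H)"

(* A cardinal is represented by a cardinal order, here the order |H| of a cofinal family H
   of least cardinality; it is determined up to order isomorphism (see cof_null). *)
definition cof_null :: "real set rel" where
  "cof_null = (SOME r. r \<in> {|\<H>| | \<H>. cofinal_null \<H>} \<and>
                 (\<forall>\<H>'. cofinal_null \<H>' \<longrightarrow> r \<le>o |\<H>'| ))"

lemma cof_null:
  shows cof_null_attained: "\<exists>\<H>. cofinal_null \<H> \<and> cof_null = |\<H>|"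
    and cof_null_least: "cofinal_null \<H>' \<Longrightarrow> cof_null \<le>o |\<H>'|"
proof -
  let ?R = "{|\<H>| | \<H>. cofinal_null \<H>}"
  have "cofinal_null (null_sets lebesgue)"
    by (auto simp: cofinal_null_def)
  then have "?R \<noteq> {}" by blast
  moreover have "\<forall>r\<in>?R. Card_order r" by (auto simp: card_of_Card_order)
  ultimately have "\<exists>r\<in>?R. \<forall>r'\<in>?R. r \<le>o r'"
    by (rule exists_minim_Card_order)
  then have "\<exists>r. r \<in> ?R \<and> (\<forall>\<H>'. cofinal_null \<H>' \<longrightarrow> r \<le>o |\<H>'| )"
    by blast
  from someI_ex[OF this]
  have *: "cof_null \<in> ?R \<and> (\<forall>\<H>'. cofinal_null \<H>' \<longrightarrow> cof_null \<le>o |\<H>'| )"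
    unfolding cof_null_def .
  then show "\<exists>\<H>. cofinal_null \<H> \<and> cof_null = |\<H>|" by blast
  from * show "cofinal_null \<H>' \<Longrightarrow> cof_null \<le>o |\<H>'|" by blast
qed

definition add_subgroup :: "'a::group_add set \<Rightarrow> bool" where
  "add_subgroup H \<longleftrightarrow> 0 \<in> H \<and> (\<forall>x\<in>H. \<forall>y\<in>H. x + y \<in> H) \<and> (\<forall>x\<in>H. - x \<in> H)"

definition left_cosets :: "'a::group_add set \<Rightarrow> 'a set set" where
  "left_cosets H = range (\<lambda>a. (+) a ` H)"

(* Groups are written additively, without assuming commutativity. *)
definition left_haar_measure :: "'a::{topological_group_add,t2_space} measure \<Rightarrow> bool" where
  "left_haar_measure \<mu> \<longleftrightarrow>
     sets \<mu> = sets borel \<and>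
     emeasure \<mu> UNIV \<noteq> 0 \<and>
     (\<forall>a. \<forall>A\<in>sets borel. emeasure \<mu> ((+) a ` A) = emeasure \<mu> A) \<and>
     (\<forall>K. compact K \<longrightarrow> emeasure \<mu> K < \<infinity>) \<and>
     (\<forall>A\<in>sets borel. emeasure \<mu> A = (INF U\<in>{U. open U \<and> A \<subseteq> U}. emeasure \<mu> U)) \<and>
     (\<forall>U. open U \<longrightarrow> emeasure \<mu> U = (SUP K\<in>{K. compact K \<and> K \<subseteq> U}. emeasure \<mu> K))"

(* A left Haar measure on a locally compact group exists and is unique up to a positive
   scalar, so on such a group the quantifier over all of them does not depend on a choice. *)
definition haar_null :: "'a::{topological_group_add,t2_space} set \<Rightarrow> bool" where
  "haar_null C \<longleftrightarrow> C \<in> sets borel \<and> (\<forall>\<mu>. left_haar_measure \<mu> \<longrightarrow> emeasure \<mu> C = 0)"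

definition nice_group :: "'a::{topological_group_add,t2_space} itself \<Rightarrow> bool" where
  "nice_group (_ :: 'a itself) \<longleftrightarrow>
     locally_compact_space (euclidean :: 'a topology) \<and>
     (\<exists>C :: 'a set. compact C \<and> haar_null C \<and>
        (\<exists>A. |A| \<le>o cof_null \<and> (\<Union>a\<in>A. (+) a ` C) = UNIV))"

end

theory Submission
  imports Defs
begin

text \<open>
  The proof combines a combinatorial description of the cofinality of the null ideal with a
  construction of a compact null set \<open>C\<close> that works at a decreasing sequence of scales and uses
  no structure theory of locally compact groups.

  \<^emph>\<open>Slaloms.\<close> By an argument of Bartoszynski there is a family of at most \<open>cof_null\<close> many
  sequences \<open>S\<close> of finite sets \<open>S n\<close> of naturals, with \<open>card (S n) \<le> 2 ^ n\<close>, such that every function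
  \<open>f\<close> on the naturals satisfies \<open>f n \<in> S n\<close> for all \<open>n\<close>, for some \<open>S\<close> of the family
  (\<open>cof_null_slaloms\<close>). To see this, one attaches to each \<open>f\<close> the null set of all reals that lie in
  infinitely many of the sets \<open>G (n, f n)\<close>, where the \<open>G (n, i)\<close> are independent open sets of relative
  measure \<open>2 ^ -n\<close> in the unit interval. If a null set \<open>H\<close> contains it, then a closed set of positive measure that misses \<open>H\<close>
  determines, by the Baire category theorem and independence, countably many slaloms, one of which
  captures \<open>f\<close> (\<open>slaloms_of_null_set\<close>).

  \<^emph>\<open>The compact set.\<close> One chooses symmetric compact neighbourhoods \<open>A m\<close> of zero and finite sets
  \<open>Q m\<close> such that \<open>A (m + 1)\<close> is very small compared with \<open>A m\<close>, and \<open>Q m + A m\<close> covers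
  \<open>4 * A 0\<close>, the fourfold sum. Since \<open>A (m + 1)\<close> is chosen after \<open>Q m\<close>, the set
  \<open>E m = Q m + 3 * A (m + 1)\<close> can be made as small as desired; smallness is expressed by many
  disjoint translates of \<open>3 * A (m + 1)\<close> inside \<open>2 * A 0\<close>, and hence holds for all Haar measures at
  once. The set is \<open>C = (\<Inter>n. \<Union>m\<in>{2 ^ n..<2 ^ (n + 1)}. E m)\<close>.

  \<^emph>\<open>Why few translates suffice.\<close> Given arbitrary points \<open>s m\<close> of \<open>2 * A 0\<close>, a single point \<open>\<tau>\<close> moves
  all of them into position: at step \<open>m\<close> one writes \<open>s m\<close> minus the current shift as \<open>q + d\<close> with
  \<open>q \<in> Q m\<close> and \<open>d \<in> A m\<close>, and adds \<open>d\<close> to the shift; all later corrections are of size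
  \<open>2 * A (m + 1)\<close>, so every point within \<open>A (m + 1)\<close> of \<open>s m\<close> is translated into \<open>E m\<close>
  (\<open>translate_into_covers\<close>). If \<open>f n\<close> is the code of an approximation of \<open>x \<in> A 0\<close> up to
  \<open>A (2 ^ (n + 1))\<close>, then a slalom \<open>S\<close> provides at most \<open>2 ^ n\<close> candidates for this approximation, and
  they are treated at the \<open>2 ^ n\<close> steps \<open>m\<close> with \<open>2 ^ n \<le> m < 2 ^ (n + 1)\<close>. Thus the point \<open>\<tau>\<close> of \<open>S\<close>
  satisfies \<open>x - \<tau> \<in> C\<close> for all \<open>x\<close> captured by \<open>S\<close>, and \<open>A 0\<close> is covered by \<open>cof_null\<close> many
  translates of \<open>C\<close> (\<open>cover_by_slaloms\<close>). Finally, some open subgroup is a union of countably many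
  translates of \<open>A 0\<close>, so the hypothesis on its index yields the whole group
  (\<open>cover_by_nbhd_translates\<close>).
\<close>

section \<open>Independent open sets of reals\<close>

text \<open>
  For \<open>e = prod_encode (n, i)\<close>, a real \<open>x\<close> lies in \<open>rare e\<close> if the last \<open>n\<close> of its first
  \<open>(e + 1)\<^sup>2\<close> binary digits after the point vanish. As \<open>n \<le> e\<close>, these digits come after the first
  \<open>e\<^sup>2\<close> ones, so different \<open>e\<close> use disjoint sets of digits. Points \<open>x\<close> for which
  \<open>2 ^ ((e + 1)\<^sup>2) * x\<close> is an integer are left out to make the set open.
\<close>

definition rare :: "nat \<Rightarrow> real set" where
  "rare e = {x. \<exists>j::int. 2 ^ fst (prod_decode e) dvd j \<and>
     real_of_int j < 2 ^ (Suc e * Suc e) * x \<and> 2 ^ (Suc e * Suc e) * x < real_of_int j + 1}"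

lemma open_rare: "open (rare e)"
proof -
  have "rare e = (\<Union>j\<in>{j::int. 2 ^ fst (prod_decode e) dvd j}.
      {x. real_of_int j < 2 ^ (Suc e * Suc e) * x} \<inter> {x. 2 ^ (Suc e * Suc e) * x < real_of_int j + 1})"
    unfolding rare_def by blast
  then show ?thesis
    by (auto intro!: open_UN open_Int open_Collect_less continuous_intros)
qed

lemma rare_floor: "x \<in> rare e \<Longrightarrow> 2 ^ fst (prod_decode e) dvd \<lfloor>2 ^ (Suc e * Suc e) * x\<rfloor>"
  unfolding rare_def
  by (smt (verit, ccfv_SIG) floor_unique mem_Collect_eq)

lemma irrational_mem_rare:
  assumes "x \<notin> \<rat>" and dvd: "2 ^ fst (prod_decode e) dvd \<lfloor>2 ^ (Suc e * Suc e) * x\<rfloor>"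
  shows "x \<in> rare e"
proof -
  let ?c = "2 ^ (Suc e * Suc e) :: real"
  have "?c * x \<noteq> real_of_int \<lfloor>?c * x\<rfloor>"
  proof
    assume "?c * x = real_of_int \<lfloor>?c * x\<rfloor>"
    then have "x = real_of_int \<lfloor>?c * x\<rfloor> / ?c"
      by (metis nonzero_mult_div_cancel_left power_not_zero zero_neq_numeral)
    also have "\<dots> \<in> \<rat>"
      by (intro Rats_divide Rats_power) auto
    finally show False using assms(1) by simp
  qed
  then have "real_of_int \<lfloor>?c * x\<rfloor> < ?c * x"
    using of_int_floor_le[of "?c * x"] by linarith
  moreover have "?c * x < real_of_int \<lfloor>?c * x\<rfloor> + 1"
    by (rule real_of_int_floor_add_one_gt)
  ultimately show ?thesis
    unfolding rare_def using dvd by blast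
qed

lemma card_multiples_below_power2:
  assumes "n \<le> k"
  shows "card {r \<in> {0..<2 ^ k}. (2::int) ^ n dvd r} = 2 ^ (k - n)"
proof -
  have eq: "(2::int) ^ k = 2 ^ n * 2 ^ (k - n)"
    using assms by (metis le_add_diff_inverse power_add)
  have "{r \<in> {0..<2 ^ k}. (2::int) ^ n dvd r} = (*) (2 ^ n) ` {0..<2 ^ (k - n)}"
  proof (intro equalityI subsetI)
    fix r assume "r \<in> {r \<in> {0..<2 ^ k}. (2::int) ^ n dvd r}"
    then obtain s where s: "r = 2 ^ n * s" and "0 \<le> 2 ^ n * s" "2 ^ n * s < 2 ^ n * 2 ^ (k - n)"
      unfolding eq by auto
    then show "r \<in> (*) (2 ^ n) ` {0..<2 ^ (k - n)}"
      by (auto simp: zero_le_mult_iff)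
  qed (auto simp: eq)
  then show ?thesis
    by (simp add: card_image inj_on_def nat_power_eq)
qed

lemma measure_floor_le:
  assumes "c > 0" "finite J" "L \<in> sets lebesgue" "\<And>x. x \<in> L \<Longrightarrow> \<lfloor>c * x\<rfloor> \<in> J"
  shows "measure lebesgue L \<le> card J / c"
proof -
  let ?I = "\<lambda>j::int. {real_of_int j / c .. (real_of_int j + 1) / c}"
  have sub: "L \<subseteq> (\<Union>j\<in>J. ?I j)"
  proof
    fix x assume "x \<in> L"
    moreover have "x \<in> ?I \<lfloor>c * x\<rfloor>"
      using assms(1) floor_correct[of "c * x"]
      by (auto simp: pos_divide_le_eq pos_le_divide_eq mult.commute)
    ultimately show "x \<in> (\<Union>j\<in>J. ?I j)"
      using assms(4) by blast
  qed
  have "measure lebesgue L \<le> measure lebesgue (\<Union>j\<in>J. ?I j)"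
    using assms by (intro measure_mono_fmeasurable sub) auto
  also have "\<dots> \<le> (\<Sum>j\<in>J. measure lebesgue (?I j))"
    using assms by (intro measure_UNION_le) auto
  also have "\<dots> = (\<Sum>j\<in>J. 1 / c)"
    using assms(1) by (intro sum.cong) (auto simp: divide_right_mono simp flip: diff_divide_distrib)
  finally show ?thesis by simp
qed

lemma measure_rare_le: "measure lebesgue (rare (prod_encode (n, i)) \<inter> {0..<1}) \<le> (1 / 2) ^ n"
proof -
  let ?e = "prod_encode (n, i)"
  let ?k = "Suc ?e * Suc ?e"
  let ?J = "{r \<in> {0..<2 ^ ?k}. (2::int) ^ n dvd r}"
  have nk: "n \<le> ?k"
    using le_prod_encode_1[of n i] by simp
  have "measure lebesgue (rare ?e \<inter> {0..<1}) \<le> card ?J / 2 ^ ?k"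
  proof (rule measure_floor_le)
    fix x assume x: "x \<in> rare ?e \<inter> {0..<1}"
    then have "2 ^ ?k * x < 2 ^ ?k" by simp
    then show "\<lfloor>2 ^ ?k * x\<rfloor> \<in> ?J"
      using x rare_floor[of x ?e] by (auto simp: floor_less_iff)
  next
    have "finite {0..<(2::int) ^ ?k}" by simp
    then show "finite ?J" by (rule rev_finite_subset) blast
  qed (auto intro!: sets.Int simp: borel_open[OF open_rare])
  also have "\<dots> = 2 ^ (?k - n) / 2 ^ ?k"
    unfolding card_multiples_below_power2[OF nk] by (simp only: of_nat_power of_nat_numeral)
  also have "\<dots> = (1 / 2) ^ n"
    using power_diff[OF _ nk, of "2 :: real"] by (simp add: power_divide del: mult_Suc mult_Suc_right)
  finally show ?thesis .
qed

text \<open>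
  One half of independence. By induction on \<open>E\<close>, the first \<open>E\<^sup>2\<close> binary digits of a point of \<open>L\<close> take
  at most as many values as expected from the conditions that come from the \<open>e \<in> P\<close> with \<open>e < E\<close>.
\<close>

lemma measure_avoiding_rare:
  assumes L: "L \<in> sets lebesgue" "L \<subseteq> {0..<1}" "L \<inter> \<rat> = {}"
    and P: "finite P" "\<And>e. e \<in> P \<Longrightarrow> L \<inter> rare e = {}"
  shows "measure lebesgue L \<le> (\<Prod>e\<in>P. 1 - (1 / 2) ^ fst (prod_decode e))"
proof -
  let ?w = "\<lambda>e. 1 - (1 / 2 :: real) ^ fst (prod_decode e)"
  have w: "0 \<le> ?w e" for e by (simp add: power_le_one)
  have floors: "\<exists>J. finite J \<and> (\<forall>x\<in>L. \<lfloor>2 ^ (E * E) * x\<rfloor> \<in> J) \<and>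
      real (card J) \<le> 2 ^ (E * E) * (\<Prod>e\<in>P \<inter> {..<E}. ?w e)" for E
  proof (induction E)
    case 0
    show ?case
      using L(2) by (intro exI[of _ "{0::int}"]) (auto simp: floor_unique)
  next
    case (Suc E)
    then obtain J where J: "finite J" "\<And>x. x \<in> L \<Longrightarrow> \<lfloor>2 ^ (E * E) * x\<rfloor> \<in> J"
      "real (card J) \<le> 2 ^ (E * E) * (\<Prod>e\<in>P \<inter> {..<E}. ?w e)" by blast
    define n where "n = fst (prod_decode E)"
    define k where "k = Suc (2 * E)"
    have nE: "n \<le> E"
      unfolding n_def by (metis le_prod_encode_1 prod.collapse prod_decode_inverse)
    then have nk: "n \<le> k" unfolding k_def by simp
    have EE: "Suc E * Suc E = E * E + k" unfolding k_def by simp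
    define R :: "int set" where "R = {r \<in> {0..<2 ^ k}. E \<in> P \<longrightarrow> \<not> 2 ^ n dvd r}"
    have fR: "finite R"
      unfolding R_def by (rule finite_subset[of _ "{0..<2 ^ k}"]) auto
    have cR: "real (card R) = 2 ^ k * (if E \<in> P then ?w E else 1)"
    proof (cases "E \<in> P")
      case True
      let ?M = "{r \<in> {0..<2 ^ k}. (2::int) ^ n dvd r}"
      have "R = {0..<2 ^ k} - ?M" using True unfolding R_def by auto
      then have "card R = card {0..<(2::int) ^ k} - card ?M"
        by (metis (no_types, lifting) card_Diff_subset finite_atLeastLessThan_int finite_subset
            mem_Collect_eq subsetI)
      also have "\<dots> = 2 ^ k - 2 ^ (k - n)"
        unfolding card_multiples_below_power2[OF nk] by (simp add: nat_power_eq)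
      finally have "real (card R) = 2 ^ k - 2 ^ (k - n)"
        by (simp add: of_nat_diff power_increasing)
      also have "\<dots> = 2 ^ k * ?w E"
        unfolding n_def[symmetric] by (simp add: power_diff[OF _ nk] power_divide right_diff_distrib)
      finally show ?thesis using True by simp
    next
      case False
      then have "R = {0..<2 ^ k}" unfolding R_def by auto
      then show ?thesis using False by (simp add: nat_power_eq)
    qed
    define J' where "J' = (\<lambda>(a, r). a * 2 ^ k + r) ` (J \<times> R)"
    have "\<lfloor>2 ^ (Suc E * Suc E) * x\<rfloor> \<in> J'" if x: "x \<in> L" for x
    proof -
      define y where "y = \<lfloor>2 ^ (Suc E * Suc E) * x\<rfloor>"
      have "y div 2 ^ k = \<lfloor>2 ^ (Suc E * Suc E) * x / real_of_int (2 ^ k)\<rfloor>"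
        unfolding y_def by (rule floor_divide_real_eq_div[symmetric]) simp
      also have "2 ^ (Suc E * Suc E) * x / real_of_int (2 ^ k) = 2 ^ (E * E) * x"
        unfolding EE by (simp add: power_add)
      finally have "y div 2 ^ k \<in> J" using J(2) x by simp
      moreover have "y mod 2 ^ k \<in> R"
      proof -
        have "\<not> 2 ^ n dvd y mod 2 ^ k" if "E \<in> P"
        proof
          assume "2 ^ n dvd y mod 2 ^ k"
          then have "2 ^ n dvd y"
            by (meson dvd_mod_iff le_imp_power_dvd nk)
          then have "x \<in> rare E"
            using x L(3) unfolding y_def n_def by (intro irrational_mem_rare) auto
          then show False using P(2) that x by blast
        qed
        then show ?thesis unfolding R_def by simp
      qed
      ultimately have "(y div 2 ^ k) * 2 ^ k + y mod 2 ^ k \<in> J'"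
        unfolding J'_def by force
      then have "y \<in> J'" by (simp only: div_mult_mod_eq)
      then show ?thesis unfolding y_def .
    qed
    moreover have "real (card J') \<le> 2 ^ (Suc E * Suc E) * (\<Prod>e\<in>P \<inter> {..<Suc E}. ?w e)"
    proof -
      have "real (card J') \<le> real (card J) * real (card R)"
        unfolding J'_def of_nat_mult[symmetric] card_cartesian_product[symmetric]
        using J(1) fR by (intro of_nat_mono card_image_le) auto
      also have "\<dots> \<le> (2 ^ (E * E) * (\<Prod>e\<in>P \<inter> {..<E}. ?w e)) * (2 ^ k * (if E \<in> P then ?w E else 1))"
        unfolding cR using J(3) w[of E] by (intro mult_right_mono) auto
      also have "\<dots> = 2 ^ (E * E + k) * ((\<Prod>e\<in>P \<inter> {..<E}. ?w e) * (if E \<in> P then ?w E else 1))"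
        unfolding power_add by simp
      also have "(\<Prod>e\<in>P \<inter> {..<E}. ?w e) * (if E \<in> P then ?w E else 1) = (\<Prod>e\<in>P \<inter> {..<Suc E}. ?w e)"
        unfolding lessThan_Suc by (auto simp: Int_insert_right mult.commute)
      finally show ?thesis unfolding EE .
    qed
    moreover have "finite J'" unfolding J'_def using J(1) fR by simp
    ultimately show ?case by blast
  qed
  obtain E where E: "P \<subseteq> {..<E}"
    using P(1) finite_nat_bounded by blast
  obtain J where J: "finite J" "\<And>x. x \<in> L \<Longrightarrow> \<lfloor>2 ^ (E * E) * x\<rfloor> \<in> J"
    "real (card J) \<le> 2 ^ (E * E) * (\<Prod>e\<in>P \<inter> {..<E}. ?w e)"
    using floors[of E] by meson
  have "measure lebesgue L \<le> card J / 2 ^ (E * E)"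
    using J L by (intro measure_floor_le) auto
  also have "\<dots> \<le> (\<Prod>e\<in>P \<inter> {..<E}. ?w e)"
    using J(3) by (simp add: pos_divide_le_eq mult.commute)
  finally show ?thesis using E by (simp add: Int_absorb2)
qed

text \<open>
  The set \<open>S n\<close> cannot have more than \<open>2 ^ n\<close> elements infinitely often, because each such \<open>n\<close>
  contributes a factor of at most \<open>(1 - 2 ^ -n) ^ (2 ^ n) \<le> exp (- 1)\<close> to the bound for the measure
  of \<open>L\<close>.
\<close>

lemma avoided_rare_eventually_few:
  assumes L: "L \<in> sets lebesgue" "L \<subseteq> {0..<1}" "L \<inter> \<rat> = {}" "measure lebesgue L > 0"
  defines "S \<equiv> \<lambda>n. {i. L \<inter> rare (prod_encode (n, i)) = {}}"
  shows "\<exists>N. \<forall>n\<ge>N. finite (S n) \<and> card (S n) \<le> 2 ^ n"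
proof (rule ccontr)
  let ?bad = "{n. \<not> (finite (S n) \<and> card (S n) \<le> 2 ^ n)}"
  assume "\<nexists>N. \<forall>n\<ge>N. finite (S n) \<and> card (S n) \<le> 2 ^ n"
  then have inf: "infinite ?bad"
    by (metis (mono_tags, lifting) finite_nat_set_iff_bounded_le mem_Collect_eq not_less_eq_eq)
  have "\<exists>T. T \<subseteq> S n \<and> finite T \<and> card T = 2 ^ n" if "n \<in> ?bad" for n
  proof (cases "finite (S n)")
    case True
    then have "2 ^ n \<le> card (S n)" using that by simp
    then show ?thesis
      using True obtain_subset_with_card_n finite_subset by metis
  next
    case False
    then show ?thesis using infinite_arbitrarily_large[of "S n" "2 ^ n"] by metis
  qed
  then obtain T where T: "\<And>n. n \<in> ?bad \<Longrightarrow> T n \<subseteq> S n \<and> finite (T n) \<and> card (T n) = 2 ^ n"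
    by metis
  obtain r where r: "exp (- 1) ^ r < measure lebesgue L"
    using real_arch_pow_inv[OF L(4), of "exp (- 1)"] by auto
  obtain B where B: "finite B" "card B = r" "B \<subseteq> ?bad"
    using infinite_arbitrarily_large[OF inf] by blast
  have TB: "\<And>n. n \<in> B \<Longrightarrow> T n \<subseteq> S n \<and> finite (T n) \<and> card (T n) = 2 ^ n"
    using T B(3) by blast
  have "measure lebesgue L \<le> (\<Prod>e\<in>prod_encode ` Sigma B T. 1 - (1 / 2) ^ fst (prod_decode e))"
  proof (rule measure_avoiding_rare[OF L(1-3)])
    show "finite (prod_encode ` Sigma B T)" using TB B(1) by auto
    show "L \<inter> rare e = {}" if "e \<in> prod_encode ` Sigma B T" for e
      using that TB unfolding S_def by blast
  qed
  also have "\<dots> = (\<Prod>p\<in>Sigma B T. 1 - (1 / 2) ^ fst p)"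
    by (subst prod.reindex) (auto simp: inj_prod_encode)
  also have "\<dots> = (\<Prod>n\<in>B. \<Prod>i\<in>T n. 1 - (1 / 2) ^ n)"
    using B(1) TB by (subst prod.Sigma) (auto simp: case_prod_beta)
  also have "\<dots> = (\<Prod>n\<in>B. (1 - (1 / 2) ^ n) ^ 2 ^ n)"
    using TB by (intro prod.cong) auto
  also have "\<dots> \<le> (\<Prod>n\<in>B. exp (- 1))"
  proof (intro prod_mono conjI)
    fix n
    have "(1 - (1 / 2 :: real) ^ n) ^ 2 ^ n \<le> exp (- ((1 / 2) ^ n)) ^ 2 ^ n"
      using exp_ge_add_one_self[of "- ((1 / 2 :: real) ^ n)"]
      by (intro power_mono) (auto simp: power_le_one)
    also have "\<dots> = exp (real (2 ^ n) * - ((1 / 2) ^ n))"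
      by (rule exp_of_nat_mult[symmetric])
    also have "real (2 ^ n) * - ((1 / 2) ^ n) = - 1"
      by (simp add: power_divide)
    finally show "(1 - (1 / 2 :: real) ^ n) ^ 2 ^ n \<le> exp (- 1)" .
  qed (auto simp: power_le_one)
  also have "\<dots> = exp (- 1) ^ r" using B(2) by simp
  finally show False using r by simp
qed

section \<open>Slaloms from a cofinal family of null sets\<close>

text \<open>
  A slalom is a sequence \<open>S\<close> of finite sets whose \<open>n\<close>-th member has at most \<open>2 ^ n\<close> elements; it
  captures \<open>f\<close> if \<open>f n \<in> S n\<close> for all \<open>n\<close>. The family is required to capture every \<open>f\<close>. The bound \<open>2 ^ n\<close> at \<open>n = 0\<close> and capturing at every \<open>n\<close>,
  rather than at almost every \<open>n\<close>, are harmless since finitely many values can be prescribed.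
\<close>

definition capturing_slaloms :: "(nat \<Rightarrow> nat set) set \<Rightarrow> bool" where
  "capturing_slaloms \<S> \<longleftrightarrow>
     (\<forall>S\<in>\<S>. \<forall>n. finite (S n) \<and> card (S n) \<le> 2 ^ n) \<and> (\<forall>f. \<exists>S\<in>\<S>. \<forall>n. f n \<in> S n)"

text \<open>The null set that codes \<open>f\<close>: the points of the unit interval that lie in infinitely many of the
  sets \<open>rare (prod_encode (n, f n))\<close>.\<close>

definition code_null :: "(nat \<Rightarrow> nat) \<Rightarrow> real set" where
  "code_null f = limsup (\<lambda>n. rare (prod_encode (n, f n)) \<inter> {0..<1})"

lemma code_null_null: "code_null f \<in> null_sets lebesgue"
  unfolding code_null_def
proof (rule borel_cantelli_limsup1)
  fix n
  let ?A = "rare (prod_encode (n, f n)) \<inter> {0..<1}"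
  show "?A \<in> sets lebesgue"
    by (auto intro!: sets.Int simp: borel_open[OF open_rare])
  have "emeasure lebesgue ?A \<le> emeasure lebesgue {0..<1::real}"
    by (intro emeasure_mono) auto
  then show "emeasure lebesgue ?A < \<infinity>"
    by (simp add: le_less_trans)
next
  show "summable (\<lambda>n. measure lebesgue (rare (prod_encode (n, f n)) \<inter> {0..<1}))"
    by (rule summable_comparison_test'[OF summable_geometric, of "1/2" 0])
      (auto simp: measure_rare_le)
qed

text \<open>
  Inner regularity gives a closed set \<open>T\<close> of positive measure; removing from it all basic open sets
  that meet it in a null set makes every nonempty relatively open part non-null.
\<close>

lemma exists_closed_fat_subset:
  assumes "N \<in> null_sets lebesgue"
  obtains K where "closed K" "K \<noteq> {}" "K \<subseteq> {0..<1::real}" "K \<inter> N = {}"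
    "\<And>U. open U \<Longrightarrow> K \<inter> U \<noteq> {} \<Longrightarrow> measure lebesgue (K \<inter> U) > 0"
proof -
  let ?S = "{0..<1::real} - N"
  have S: "?S \<in> sets lebesgue" using assms by auto
  obtain T where T: "closed T" "T \<subseteq> ?S" "emeasure lebesgue (?S - T) < ennreal 1"
    by (rule sets_lebesgue_inner_closed[OF S, of 1]) auto
  have Tm: "T \<in> sets lebesgue" using T(1) by simp
  have "emeasure lebesgue T \<noteq> 0"
  proof
    assume 0: "emeasure lebesgue T = 0"
    have "emeasure lebesgue (?S - T) = emeasure lebesgue ?S"
      using Tm 0 S by (intro emeasure_Diff_null_set) (auto simp: null_sets_def)
    also have "\<dots> = emeasure lebesgue {0..<1::real}"
      using assms by (intro emeasure_Diff_null_set) auto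
    also have "\<dots> = ennreal 1" by simp
    finally show False using T(3) by simp
  qed
  obtain \<B> :: "real set set" where \<B>: "countable \<B>" "topological_basis \<B>"
    using ex_countable_basis by blast
  let ?Z = "{I \<in> \<B>. T \<inter> I \<in> null_sets lebesgue}"
  define K where "K = T - \<Union>?Z"
  have opB: "open I" if "I \<in> \<B>" for I using \<B>(2) that topological_basis_open by blast
  have K: "closed K" unfolding K_def using T(1) opB by (intro closed_Diff open_Union) auto
  have null: "T \<inter> \<Union>?Z \<in> null_sets lebesgue"
  proof -
    have "(\<Union>I\<in>?Z. T \<inter> I) \<in> null_sets lebesgue"
      using \<B>(1) by (intro null_sets_UN') auto
    also have "(\<Union>I\<in>?Z. T \<inter> I) = T \<inter> \<Union>?Z" by (rule Int_Union[symmetric])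
    finally show ?thesis .
  qed
  have K01: "K \<subseteq> {0..<1}" using T(2) unfolding K_def by auto
  have pos: "measure lebesgue (K \<inter> U) > 0" if U: "open U" "K \<inter> U \<noteq> {}" for U
  proof -
    obtain x where x: "x \<in> K" "x \<in> U" using U by blast
    obtain I where I: "I \<in> \<B>" "x \<in> I" "I \<subseteq> U" using topological_basisE[OF \<B>(2) U(1) x(2)] .
    have nn: "T \<inter> I \<notin> null_sets lebesgue"
      using x(1) I unfolding K_def by auto
    have KU: "K \<inter> U \<in> sets lebesgue" using K U by auto
    have "K \<inter> U \<notin> null_sets lebesgue"
    proof
      assume "K \<inter> U \<in> null_sets lebesgue"
      then have "(K \<inter> U) \<union> (T \<inter> \<Union>?Z) \<in> null_sets lebesgue"
        using null by blast
      moreover have "T \<inter> I \<subseteq> (K \<inter> U) \<union> (T \<inter> \<Union>?Z)"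
        using I unfolding K_def by auto
      moreover have "T \<inter> I \<in> sets lebesgue" using T(1) opB[OF I(1)] by auto
      ultimately show False using nn null_sets_subset by blast
    qed
    then have "emeasure lebesgue (K \<inter> U) \<noteq> 0" using KU by (auto simp: null_sets_def)
    moreover have "K \<inter> U \<in> lmeasurable"
    proof (rule bounded_set_imp_lmeasurable[OF _ KU])
      have "K \<inter> U \<subseteq> {0..1}" using K01 by auto
      then show "bounded (K \<inter> U)" using bounded_closed_interval bounded_subset by blast
    qed
    ultimately show ?thesis
      by (metis emeasure_eq_measure2 ennreal_0 zero_less_measure_iff)
  qed
  have "K \<noteq> {}"
  proof
    assume "K = {}"
    then have "T \<inter> \<Union>?Z = T" unfolding K_def by blast
    then show False using null \<open>emeasure lebesgue T \<noteq> 0\<close> by auto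
  qed
  then show thesis
    using that[OF K _ K01 _ pos] T(2) unfolding K_def by blast
qed

text \<open>
  Let \<open>K\<close> be a fat closed set disjoint from \<open>H\<close>. If \<open>code_null f \<subseteq> H\<close>, then the relatively open
  sets \<open>K \<inter> (\<Union>n\<ge>m. rare (prod_encode (n, f n)))\<close> have empty intersection, so by the Baire category
  theorem one of them misses a nonempty \<open>K \<inter> I\<close> with \<open>I\<close> basic open. Hence \<open>f n\<close> is, for all
  \<open>n \<ge> m\<close>, one of the few indices whose rare set misses \<open>K \<inter> I\<close>.
\<close>

lemma slaloms_of_null_set:
  assumes "H \<in> null_sets lebesgue"
  obtains \<S> :: "(nat \<Rightarrow> nat set) set" where "countable \<S>"
    "\<And>S n. S \<in> \<S> \<Longrightarrow> finite (S n) \<and> card (S n) \<le> 2 ^ n"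
    "\<And>f. code_null f \<subseteq> H \<Longrightarrow> \<exists>S\<in>\<S>. \<forall>n. f n \<in> S n"
proof -
  have "(\<rat> :: real set) \<in> null_sets lebesgue"
    by (intro null_sets_completionI countable_imp_null_set_lborel countable_rat)
  \<comment> \<open>The rationals are avoided as well, since the digits of a dyadic rational do not decide
    its membership in \<open>rare e\<close>.\<close>
  then have HQ: "H \<union> \<rat> \<in> null_sets lebesgue" using assms by blast
  obtain K where K: "closed K" "K \<noteq> {}" "K \<subseteq> {0..<1}" "K \<inter> (H \<union> \<rat>) = {}"
    and pos: "\<And>U. open U \<Longrightarrow> K \<inter> U \<noteq> {} \<Longrightarrow> measure lebesgue (K \<inter> U) > 0"
    using exists_closed_fat_subset[OF HQ] by metis
  obtain \<B> :: "real set set" where \<B>: "countable \<B>" "topological_basis \<B>"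
    using ex_countable_basis by blast
  have opB: "open I" if "I \<in> \<B>" for I using \<B>(2) that topological_basis_open by blast
  define V where "V I n = {i. K \<inter> I \<inter> rare (prod_encode (n, i)) = {}}" for I n
  \<comment> \<open>The list prescribes finitely many initial values exactly; the remaining ones come from \<open>V I\<close>.\<close>
  define W :: "real set \<times> nat list \<Rightarrow> nat \<Rightarrow> nat set" where
    "W = (\<lambda>(I, xs) n. if n < length xs then {xs ! n}
       else if finite (V I n) \<and> card (V I n) \<le> 2 ^ n then V I n else {})"
  show thesis
  proof
    show "countable (W ` (\<B> \<times> UNIV))"
      using \<B>(1) by (intro countable_image countable_SIGMA) auto
    show "finite (S n) \<and> card (S n) \<le> 2 ^ n" if "S \<in> W ` (\<B> \<times> UNIV)" for S n
      using that by (auto simp: W_def)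
    fix f assume f: "code_null f \<subseteq> H"
    let ?T = "\<lambda>m. K \<inter> (\<Union>n\<in>{m..}. rare (prod_encode (n, f n)))"
    have "(\<Inter>m. ?T m) \<subseteq> code_null f"
      using K(3) unfolding code_null_def limsup_INF_SUP by blast
    then have empty: "(\<Inter>m. ?T m) = {}"
      using f K(4) by blast
    have "\<not> (\<forall>m. K \<subseteq> closure (?T m))"
    proof
      assume dense: "\<forall>m. K \<subseteq> closure (?T m)"
      have "K \<subseteq> closure (\<Inter>(range ?T))"
      proof (rule Baire[OF K(1)])
        fix T assume "T \<in> range ?T"
        then show "openin (top_of_set K) T \<and> K \<subseteq> closure T"
          using dense by (auto intro!: openin_open_Int open_UN simp: open_rare)
      qed simp
      then show False using empty K(2) by simp
    qed
    then obtain m x where x: "x \<in> K" "x \<notin> closure (?T m)" by blast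
    obtain I where I: "I \<in> \<B>" "x \<in> I" "I \<subseteq> - closure (?T m)"
      using topological_basisE[OF \<B>(2), of "- closure (?T m)" x] x by auto
    have fV: "f n \<in> V I n" if "n \<ge> m" for n
      using I(3) that closure_subset[of "?T m"] unfolding V_def by auto
    have "\<exists>N. \<forall>n\<ge>N. finite (V I n) \<and> card (V I n) \<le> 2 ^ n"
      unfolding V_def
      using K x(1) I(2) opB[OF I(1)] pos[OF opB[OF I(1)]]
      by (intro avoided_rare_eventually_few) auto
    then obtain N where N: "\<And>n. n \<ge> N \<Longrightarrow> finite (V I n) \<and> card (V I n) \<le> 2 ^ n" by blast
    have "f n \<in> W (I, map f [0..<max m N]) n" for n
      using fV N unfolding W_def by (auto simp del: upt_Suc)
    then show "\<exists>S\<in>W ` (\<B> \<times> UNIV). \<forall>n. f n \<in> S n"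
      using I(1) by blast
  qed
qed

lemma infinite_cofinal_null:
  assumes "cofinal_null \<H>"
  shows "infinite \<H>"
proof
  assume "finite \<H>"
  then have "\<Union>\<H> \<in> null_sets lebesgue"
    using assms unfolding cofinal_null_def by (intro null_sets.finite_Union) auto
  moreover have "\<Union>\<H> = UNIV"
  proof -
    have "x \<in> \<Union>\<H>" for x
    proof -
      have "{x} \<in> null_sets lebesgue" by (simp add: null_sets_completionI)
      then show ?thesis using assms unfolding cofinal_null_def by blast
    qed
    then show ?thesis by blast
  qed
  ultimately show False by (simp add: null_sets_def)
qed

lemma cof_null_slaloms:
  obtains \<S> where "|\<S>| \<le>o cof_null" "capturing_slaloms \<S>"
proof -
  obtain \<H> where \<H>: "cofinal_null \<H>" "cof_null = |\<H>|" using cof_null_attained by blast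
  have "\<exists>\<S> :: (nat \<Rightarrow> nat set) set. countable \<S> \<and>
    (\<forall>S\<in>\<S>. \<forall>n. finite (S n) \<and> card (S n) \<le> 2 ^ n) \<and>
    (\<forall>f. code_null f \<subseteq> H \<longrightarrow> (\<exists>S\<in>\<S>. \<forall>n. f n \<in> S n))" if "H \<in> \<H>" for H
  proof -
    have "H \<in> null_sets lebesgue" using that \<H>(1) unfolding cofinal_null_def by blast
    then show ?thesis by (rule slaloms_of_null_set) blast
  qed
  then obtain \<T> :: "real set \<Rightarrow> (nat \<Rightarrow> nat set) set" where \<T>: "\<And>H. H \<in> \<H> \<Longrightarrow> countable (\<T> H)"
    "\<And>H S n. H \<in> \<H> \<Longrightarrow> S \<in> \<T> H \<Longrightarrow> finite (S n) \<and> card (S n) \<le> 2 ^ n"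
    "\<And>H f. H \<in> \<H> \<Longrightarrow> code_null f \<subseteq> H \<Longrightarrow> \<exists>S\<in>\<T> H. \<forall>n. f n \<in> S n"
    by metis
  show thesis
  proof
    have inf: "infinite \<H>" by (rule infinite_cofinal_null[OF \<H>(1)])
    show "|\<Union>H\<in>\<H>. \<T> H| \<le>o cof_null"
      unfolding \<H>(2)
    proof (intro card_of_UNION_ordLeq_infinite inf ballI)
      fix H assume "H \<in> \<H>"
      then have "|\<T> H| \<le>o |UNIV :: nat set|"
        using \<T>(1) card_of_ordLeq[of "\<T> H" "UNIV :: nat set"] unfolding countable_def by blast
      also have "|UNIV :: nat set| \<le>o |\<H>|"
        using inf infinite_iff_card_of_nat by blast
      finally show "|\<T> H| \<le>o |\<H>|" .
    qed (rule ordIso_imp_ordLeq[OF card_of_refl])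
    show "capturing_slaloms (\<Union>H\<in>\<H>. \<T> H)"
      unfolding capturing_slaloms_def
    proof (intro conjI ballI allI)
      fix f
      obtain H where H: "H \<in> \<H>" "code_null f \<subseteq> H"
        using \<H>(1) code_null_null[of f] unfolding cofinal_null_def by blast
      obtain S where "S \<in> \<T> H" "\<forall>n. f n \<in> S n"
        using \<T>(3)[OF H] by metis
      then show "\<exists>S\<in>\<Union>H\<in>\<H>. \<T> H. \<forall>n. f n \<in> S n" using H(1) by blast
    next
      fix S n assume "S \<in> (\<Union>H\<in>\<H>. \<T> H)"
      then show "finite (S n)" "card (S n) \<le> 2 ^ n"
        using \<T>(2) by (elim UN_E, simp)+
    qed
  qed
qed

section \<open>Compact neighbourhoods of zero\<close>

text \<open>A compact neighbourhood of zero (not necessarily open) that is closed under negation.\<close>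

definition sym_compact_nbhd :: "'a::topological_group_add set \<Rightarrow> bool" where
  "sym_compact_nbhd A \<longleftrightarrow> compact A \<and> 0 \<in> interior A \<and> (\<forall>x\<in>A. - x \<in> A)"

lemma sym_compact_nbhdD:
  assumes "sym_compact_nbhd A"
  shows "compact A" "0 \<in> interior A" "x \<in> A \<Longrightarrow> - x \<in> A" "0 \<in> A"
  using assms interior_subset unfolding sym_compact_nbhd_def by auto

lemma compact_set_plus:
  fixes A B :: "'a::topological_monoid_add set"
  assumes "compact A" "compact B"
  shows "compact (A + B)"
proof -
  have "A + B = (\<lambda>p. fst p + snd p) ` (A \<times> B)"
    unfolding set_plus_def by force
  then show ?thesis
    using assms by (auto intro!: compact_continuous_image compact_Times continuous_intros)
qed

lemma compact_translation_group:
  fixes A :: "'a::topological_monoid_add set"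
  assumes "compact A"
  shows "compact ((+) a ` A)"
  using assms by (auto intro!: compact_continuous_image continuous_intros)

lemma open_translation_group:
  fixes U :: "'a::{topological_group_add,t2_space} set"
  assumes "open U"
  shows "open ((+) a ` U)"
proof -
  have "(+) a ` U = (\<lambda>x. - a + x) -` U"
    by (force simp: add.assoc[symmetric])
  then show ?thesis
    using assms by (auto intro!: open_vimage continuous_intros)
qed

lemma halve_nbhd:
  fixes N :: "'a::topological_monoid_add set"
  assumes "open N" "0 \<in> N"
  obtains U where "open U" "0 \<in> U" "U + U \<subseteq> N"
proof -
  have "open ((\<lambda>p::'a \<times> 'a. fst p + snd p) -` N)"
    using assms(1) by (intro open_vimage continuous_intros)
  moreover have "(0, 0) \<in> (\<lambda>p::'a \<times> 'a. fst p + snd p) -` N"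
    using assms(2) by simp
  ultimately obtain U V where UV: "open U" "open V" "(0, 0) \<in> U \<times> V"
    "U \<times> V \<subseteq> (\<lambda>p::'a \<times> 'a. fst p + snd p) -` N"
    by (rule open_prod_elim)
  then have "(U \<inter> V) + (U \<inter> V) \<subseteq> N"
    by (auto elim!: set_plus_elim)
  then show thesis
    using UV that[of "U \<inter> V"] by auto
qed

text \<open>
  The closure of a small symmetric open set \<open>P\<close> works, because \<open>closure P \<subseteq> P + P\<close> in a topological
  group.
\<close>

lemma exists_sym_compact_nbhd:
  fixes N :: "'a::{topological_group_add,t2_space} set"
  assumes lc: "locally_compact_space (euclidean :: 'a topology)" and N: "open N" "0 \<in> N"
  obtains A where "sym_compact_nbhd A" "A \<subseteq> N"
proof -
  obtain U K :: "'a set" where UK: "open U" "compact K" "0 \<in> U" "U \<subseteq> K"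
    using lc unfolding locally_compact_space_def by simp meson
  obtain V where V: "open V" "0 \<in> V" "V + V \<subseteq> N"
    using halve_nbhd[OF N] .
  define P where "P = (U \<inter> V) \<inter> uminus -` (U \<inter> V)"
  have P: "open P" "0 \<in> P" "\<And>x. x \<in> P \<Longrightarrow> - x \<in> P" "P \<subseteq> K" "P \<subseteq> V"
    using UK V unfolding P_def by (auto intro!: open_Int open_vimage continuous_intros)
  have "closure P \<subseteq> N"
  proof
    fix x assume x: "x \<in> closure P"
    have "x \<in> (+) x ` P" using P(2) by force
    then have "(+) x ` P \<inter> P \<noteq> {}"
      using x open_translation_group[OF P(1)] by (meson disjoint_iff open_Int_closure_eq_empty)
    then obtain u where u: "u \<in> P" "x + u \<in> P" by auto
    have "x = (x + u) + - u" by simp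
    also have "\<dots> \<in> V + V" using u P(3,5) by (intro set_plus_intro) auto
    finally show "x \<in> N" using V(3) by blast
  qed
  moreover have "closure P \<subseteq> K"
    using P(4) UK(2) by (simp add: closure_minimal compact_imp_closed)
  then have "compact (closure P)"
    using UK(2) by (metis closed_closure compact_Int_closed inf.absorb2)
  moreover have "closure P \<subseteq> uminus -` closure P"
  proof (rule closure_minimal)
    show "P \<subseteq> uminus -` closure P" using P(3) closure_subset by auto
    show "closed (uminus -` closure P)" by (intro closed_vimage continuous_intros) auto
  qed
  moreover have "0 \<in> interior (closure P)"
    using P(1,2) closure_subset interior_maximal by blast
  ultimately show thesis
    by (intro that[of "closure P"]) (auto simp: sym_compact_nbhd_def)
qed

lemma infinite_nbhd_zero:
  fixes A :: "'a::{topological_group_add,t2_space} set"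
  assumes nd: "(euclidean :: 'a topology) \<noteq> discrete_topology UNIV" and A: "0 \<in> interior A"
  shows "infinite A"
proof
  assume "finite A"
  then have "open (interior A - (A - {0}))"
    by (intro open_Diff finite_imp_closed) auto
  moreover have "interior A - (A - {0}) = {0}"
    using A interior_subset by blast
  ultimately have "open {0::'a}" by simp
  then have "open {x}" for x :: 'a
    using open_translation_group[of "{0}" x] by simp
  then have "open U" for U :: "'a set"
    using open_UN[of U "\<lambda>x. {x}"] by simp
  then have "(euclidean :: 'a topology) = discrete_topology UNIV"
    by (simp add: topology_eq)
  then show False using nd by simp
qed

text \<open>
  Zero is not isolated, so every neighbourhood \<open>B\<close> contains \<open>k\<close> distinct points; the translates by
  these points are disjoint once \<open>A' + A' + A'\<close> is too small to produce any of their nonzero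
  differences.
\<close>

lemma packing_nbhd:
  fixes A :: "'a::{topological_ab_group_add,t2_space} set"
  assumes lc: "locally_compact_space (euclidean :: 'a topology)"
    and nd: "(euclidean :: 'a topology) \<noteq> discrete_topology UNIV"
    and A: "sym_compact_nbhd A" and B: "0 \<in> interior B"
  shows "\<exists>A' P. sym_compact_nbhd A' \<and> A' + A' + A' \<subseteq> A \<and> P \<subseteq> B \<and> finite P \<and> card P = k \<and>
    disjoint_family_on (\<lambda>p. (+) p ` (A' + A' + A')) P"
proof -
  obtain P where P: "P \<subseteq> B" "finite P" "card P = k"
    using infinite_arbitrarily_large[OF infinite_nbhd_zero[OF nd B]] by metis
  define D where "D = (\<lambda>(p, q). p - q) ` (P \<times> P) - {0}"
  have "closed D" unfolding D_def using P(2) by (intro finite_imp_closed) auto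
  then have "open (interior A - D)" by auto
  moreover have "0 \<in> interior A - D"
    using sym_compact_nbhdD(2)[OF A] unfolding D_def by simp
  ultimately obtain U1 where U1: "open U1" "0 \<in> U1" "U1 + U1 \<subseteq> interior A - D"
    by (rule halve_nbhd)
  obtain U2 where U2: "open U2" "0 \<in> U2" "U2 + U2 \<subseteq> U1"
    using halve_nbhd[OF U1(1,2)] .
  obtain U3 where U3: "open U3" "0 \<in> U3" "U3 + U3 \<subseteq> U2"
    using halve_nbhd[OF U2(1,2)] .
  obtain A' where A': "sym_compact_nbhd A'" "A' \<subseteq> U3"
    using exists_sym_compact_nbhd[OF lc U3(1,2)] .
  have "A' + A' + A' \<subseteq> (U3 + U3) + (U3 + U3)"
    using A' U3(2) by (auto elim!: set_plus_elim intro!: set_plus_intro) (metis add_0_right set_plus_intro subsetD)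
  also have "\<dots> \<subseteq> U2 + U2" by (rule set_plus_mono2[OF U3(3) U3(3)])
  finally have three: "A' + A' + A' \<subseteq> U1" using U2(3) by blast
  have sub: "U1 \<subseteq> interior A - D"
  proof
    fix u assume "u \<in> U1"
    then have "u + 0 \<in> U1 + U1" using U1(2) by (intro set_plus_intro)
    then show "u \<in> interior A - D" using U1(3) by auto
  qed
  have sym: "- y \<in> A' + A' + A'" if y: "y \<in> A' + A' + A'" for y
  proof -
    obtain a b c where abc: "a \<in> A'" "b \<in> A'" "c \<in> A'" "y = a + b + c"
      using y unfolding set_plus_def by blast
    have "- y = - a + - b + - c" unfolding abc(4) by simp
    also have "\<dots> \<in> A' + A' + A'"
      using abc sym_compact_nbhdD(3)[OF A'(1)] by (intro set_plus_intro)
    finally show ?thesis .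
  qed
  have "disjoint_family_on (\<lambda>p. (+) p ` (A' + A' + A')) P"
    unfolding disjoint_family_on_def
  proof (intro ballI impI)
    fix p q assume pq: "p \<in> P" "q \<in> P" "p \<noteq> q"
    have False if "y \<in> A' + A' + A'" "z \<in> A' + A' + A'" "p + y = q + z" for y z
    proof -
      have "p - q = z + - y" using that(3) by (simp add: algebra_simps)
      also have "\<dots> \<in> U1 + U1" using that three sym by (intro set_plus_intro) auto
      finally have "p - q \<notin> D" using U1(3) by blast
      then show False using pq unfolding D_def by force
    qed
    then show "(+) p ` (A' + A' + A') \<inter> (+) q ` (A' + A' + A') = {}" by blast
  qed
  moreover have "A' + A' + A' \<subseteq> A" using three sub interior_subset by blast
  ultimately show ?thesis using P A' by blast
qed

lemma finite_net:
  fixes A :: "'a::{topological_group_add,t2_space} set"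
  assumes "compact X" "0 \<in> interior A"
  shows "\<exists>Q. finite Q \<and> X \<subseteq> Q + A"
proof -
  have "X \<subseteq> (\<Union>x\<in>X. (+) x ` interior A)"
    using assms(2) by force
  then obtain Q where Q: "Q \<subseteq> X" "finite Q" "X \<subseteq> (\<Union>x\<in>Q. (+) x ` interior A)"
    using compactE_image[OF assms(1), of X "\<lambda>x. (+) x ` interior A"]
    by (metis open_interior open_translation_group)
  have "X \<subseteq> Q + A"
    using Q(3) interior_subset[of A] by (auto intro!: set_plus_intro)
  then show ?thesis using Q(2) by blast
qed

section \<open>The compact null set\<close>

text \<open>The only properties of Haar measures that are needed.\<close>

lemma left_haar_measureD:
  fixes K :: "'a::{topological_group_add,t2_space} set"
  assumes "left_haar_measure \<mu>" "compact K"
  shows "K \<in> sets \<mu>" "emeasure \<mu> ((+) a ` K) = emeasure \<mu> K" "emeasure \<mu> K < \<infinity>"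
proof -
  have K: "K \<in> sets borel" using compact_imp_closed[OF assms(2)] by (rule borel_closed)
  note \<mu> = assms(1)[unfolded left_haar_measure_def]
  show "K \<in> sets \<mu>"
    unfolding \<mu>[THEN conjunct1] by (rule K)
  show "emeasure \<mu> ((+) a ` K) = emeasure \<mu> K"
    by (rule \<mu>[THEN conjunct2, THEN conjunct2, THEN conjunct1, rule_format, OF K])
  show "emeasure \<mu> K < \<infinity>"
    by (rule \<mu>[THEN conjunct2, THEN conjunct2, THEN conjunct2, THEN conjunct1, rule_format, OF assms(2)])
qed

text \<open>
  The neighbourhoods \<open>A m\<close> are the scales, and \<open>Q m\<close> is a net at scale \<open>A m\<close>. The last condition
  says that \<open>A (Suc m)\<close> is tiny relative to the size of \<open>Q m\<close>: it gives \<open>m\<^sup>2\<close> times as many disjoint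
  translates as are used in \<open>Q m + (A (Suc m) + A (Suc m) + A (Suc m))\<close>.
\<close>

locale scale_sequence =
  fixes A :: "nat \<Rightarrow> 'a::{topological_ab_group_add,t2_space} set" and Q :: "nat \<Rightarrow> 'a set"
  assumes nbhd: "sym_compact_nbhd (A m)"
    and shrink: "A (Suc m) + A (Suc m) + A (Suc m) \<subseteq> A m"
    and finite_Q: "finite (Q m)"
    and cover_Q: "(A 0 + A 0) + (A 0 + A 0) \<subseteq> Q m + A m"
    and packing: "\<exists>P\<subseteq>A 0. finite P \<and> card P = m * m * card (Q m) \<and>
      disjoint_family_on (\<lambda>p. (+) p ` (A (Suc m) + A (Suc m) + A (Suc m))) P"

text \<open>
  Dependent choice on \<open>A\<close> alone; the nets are fixed beforehand as a function of the neighbourhood, so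
  that the packing number for \<open>A (Suc m)\<close> is determined by \<open>A m\<close>.
\<close>

lemma exists_scale_sequence:
  assumes lc: "locally_compact_space (euclidean :: 'a::{topological_ab_group_add,t2_space} topology)"
    and nd: "(euclidean :: 'a topology) \<noteq> discrete_topology UNIV"
  shows "\<exists>(A :: nat \<Rightarrow> 'a set) Q. scale_sequence A Q"
proof -
  obtain A0 :: "'a set" where A0: "sym_compact_nbhd A0"
    using exists_sym_compact_nbhd[OF lc open_UNIV] by auto
  define X where "X = (A0 + A0) + (A0 + A0)"
  have X: "compact X" unfolding X_def
    by (intro compact_set_plus sym_compact_nbhdD(1)[OF A0])
  define net where "net B = (SOME Q. finite Q \<and> X \<subseteq> Q + B)" for B
  have net: "finite (net B)" "X \<subseteq> net B + B" if "sym_compact_nbhd B" for B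
    using someI_ex[OF finite_net[OF X sym_compact_nbhdD(2)[OF that]]] unfolding net_def by auto
  have "\<exists>A. \<forall>m. (sym_compact_nbhd (A m) \<and> (m = 0 \<longrightarrow> A m = A0)) \<and>
      (A (Suc m) + A (Suc m) + A (Suc m) \<subseteq> A m \<and>
       (\<exists>P\<subseteq>A0. finite P \<and> card P = m * m * card (net (A m)) \<and>
         disjoint_family_on (\<lambda>p. (+) p ` (A (Suc m) + A (Suc m) + A (Suc m))) P))"
  proof (rule dependent_nat_choice)
    show "\<exists>x. sym_compact_nbhd x \<and> (0 = 0 \<longrightarrow> x = A0)" using A0 by blast
    fix B and m :: nat
    assume "sym_compact_nbhd B \<and> (m = 0 \<longrightarrow> B = A0)"
    then show "\<exists>y. (sym_compact_nbhd y \<and> (Suc m = 0 \<longrightarrow> y = A0)) \<and> y + y + y \<subseteq> B \<and>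
      (\<exists>P\<subseteq>A0. finite P \<and> card P = m * m * card (net B) \<and>
        disjoint_family_on (\<lambda>p. (+) p ` (y + y + y)) P)"
      using packing_nbhd[OF lc nd _ sym_compact_nbhdD(2)[OF A0], of B "m * m * card (net B)"] by blast
  qed
  then obtain A where A: "\<And>m. sym_compact_nbhd (A m)" "A 0 = A0"
    "\<And>m. A (Suc m) + A (Suc m) + A (Suc m) \<subseteq> A m"
    "\<And>m. \<exists>P\<subseteq>A0. finite P \<and> card P = m * m * card (net (A m)) \<and>
         disjoint_family_on (\<lambda>p. (+) p ` (A (Suc m) + A (Suc m) + A (Suc m))) P"
    by metis
  have "scale_sequence A (\<lambda>m. net (A m))"
    using A net(1)[OF A(1)] net(2)[OF A(1)] unfolding X_def by unfold_locales simp_all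
  then show ?thesis by blast
qed

context scale_sequence
begin

lemma zero_mem: "0 \<in> A m"
  by (rule sym_compact_nbhdD(4)[OF nbhd])

lemma minus_mem: "x \<in> A m \<Longrightarrow> - x \<in> A m"
  by (rule sym_compact_nbhdD(3)[OF nbhd])

lemma plus3_mem: "x \<in> A (Suc m) \<Longrightarrow> y \<in> A (Suc m) \<Longrightarrow> z \<in> A (Suc m) \<Longrightarrow> x + y + z \<in> A m"
  using shrink by (blast intro: set_plus_intro)

lemma decreasing: "m \<le> n \<Longrightarrow> A n \<subseteq> A m"
proof (rule lift_Suc_antimono_le[of A])
  show "A (Suc i) \<subseteq> A i" for i
    using plus3_mem[OF _ zero_mem zero_mem] by force
qed

text \<open>The union of \<open>card (Q m)\<close> many translates of \<open>A (Suc m) + A (Suc m) + A (Suc m)\<close>, of measure at most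
  \<open>\<mu> (A 0 + A 0) / m\<^sup>2\<close> for every Haar measure \<open>\<mu>\<close> and positive \<open>m\<close>.\<close>

definition small_cover :: "nat \<Rightarrow> 'a set" where
  "small_cover m = Q m + (A (Suc m) + A (Suc m) + A (Suc m))"

text \<open>
  The required compact null set. The dyadic block \<open>{2 ^ n..<2 ^ Suc n}\<close> of indices has one index for
  each of the up to \<open>2 ^ n\<close> elements of the \<open>n\<close>-th member of a slalom, and the measure of the union
  over the block is at most \<open>2 ^ n / 4 ^ n\<close> times that of \<open>A 0 + A 0\<close>.
\<close>

definition small_set :: "'a set" where
  "small_set = (\<Inter>n. \<Union>m\<in>{2 ^ n..<2 ^ Suc n}. small_cover m)"

lemma compact_small_cover: "compact (small_cover m)"
  unfolding small_cover_def
  by (intro compact_set_plus finite_imp_compact finite_Q sym_compact_nbhdD(1)[OF nbhd])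

lemma compact_small_set: "compact small_set"
proof -
  let ?E = "\<lambda>n. \<Union>m\<in>{2 ^ n..<2 ^ Suc n}. small_cover m"
  have E: "compact (?E n)" for n by (intro compact_UN compact_small_cover) simp
  then have "closed (\<Inter>n. ?E n)" by (intro closed_INT ballI compact_imp_closed)
  then have "compact (?E 0 \<inter> (\<Inter>n. ?E n))" by (rule compact_Int_closed[OF E])
  also have "?E 0 \<inter> (\<Inter>n. ?E n) = small_set" unfolding small_set_def by blast
  finally show ?thesis .
qed

text \<open>
  By invariance, the \<open>card (Q m)\<close> translates that cover \<open>small_cover m\<close> are compared with the
  \<open>m * m * card (Q m)\<close> disjoint ones inside \<open>A 0 + A 0\<close>.
\<close>

lemma emeasure_small_cover:
  assumes \<mu>: "left_haar_measure \<mu>"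
  shows "of_nat (m * m) * emeasure \<mu> (small_cover m) \<le> emeasure \<mu> (A 0 + A 0)"
proof -
  define B where "B = A (Suc m) + A (Suc m) + A (Suc m)"
  have B: "compact B" unfolding B_def by (intro compact_set_plus sym_compact_nbhdD(1)[OF nbhd])
  note inv = left_haar_measureD(2)[OF \<mu> B]
  have tB: "(+) a ` B \<in> sets \<mu>" for a
    by (intro left_haar_measureD(1)[OF \<mu>] compact_translation_group B)
  obtain P where P: "P \<subseteq> A 0" "finite P" "card P = m * m * card (Q m)"
    "disjoint_family_on (\<lambda>p. (+) p ` B) P"
    using packing[of m] unfolding B_def by blast
  have "emeasure \<mu> (small_cover m) \<le> emeasure \<mu> (\<Union>q\<in>Q m. (+) q ` B)"
    using finite_Q tB by (intro emeasure_mono sets.finite_UN)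
      (auto simp: small_cover_def B_def elim!: set_plus_elim)
  also have "\<dots> \<le> (\<Sum>q\<in>Q m. emeasure \<mu> ((+) q ` B))"
    using finite_Q tB by (intro emeasure_subadditive_finite) auto
  also have "\<dots> = of_nat (card (Q m)) * emeasure \<mu> B"
    by (simp add: inv)
  finally have "of_nat (m * m) * emeasure \<mu> (small_cover m) \<le>
      of_nat (m * m) * (of_nat (card (Q m)) * emeasure \<mu> B)"
    by (rule mult_left_mono) simp
  also have "\<dots> = of_nat (card P) * emeasure \<mu> B"
    unfolding P(3) by (simp add: mult.assoc)
  also have "\<dots> = (\<Sum>p\<in>P. emeasure \<mu> ((+) p ` B))"
    by (simp add: inv)
  also have "\<dots> = emeasure \<mu> (\<Union>p\<in>P. (+) p ` B)"
    using P tB by (intro sum_emeasure) auto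
  also have "\<dots> \<le> emeasure \<mu> (A 0 + A 0)"
  proof (rule emeasure_mono)
    have "B \<subseteq> A 0" using shrink[of m] decreasing[of 0 m] unfolding B_def by auto
    then show "(\<Union>p\<in>P. (+) p ` B) \<subseteq> A 0 + A 0"
      using P(1) by (auto intro!: set_plus_intro)
    show "A 0 + A 0 \<in> sets \<mu>"
      by (intro left_haar_measureD(1)[OF \<mu>] compact_set_plus sym_compact_nbhdD(1)[OF nbhd])
  qed
  finally show ?thesis .
qed

lemma haar_null_small_set: "haar_null small_set"
  unfolding haar_null_def
proof (intro conjI allI impI)
  show "small_set \<in> sets borel"
    by (intro borel_closed compact_imp_closed compact_small_set)
  fix \<mu> :: "'a measure"
  assume \<mu>: "left_haar_measure \<mu>"
  have sets: "small_cover m \<in> sets \<mu>" for m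
    by (intro left_haar_measureD(1)[OF \<mu>] compact_small_cover)
  let ?M = "emeasure \<mu> (A 0 + A 0)"
  have fin: "?M < \<infinity>"
    by (intro left_haar_measureD(3)[OF \<mu>] compact_set_plus sym_compact_nbhdD(1)[OF nbhd])
  have bound: "of_nat (4 ^ n) * emeasure \<mu> small_set \<le> of_nat (2 ^ n) * ?M" for n :: nat
  proof -
    let ?I = "{2 ^ n..<2 ^ Suc n} :: nat set"
    have "emeasure \<mu> small_set \<le> emeasure \<mu> (\<Union>m\<in>?I. small_cover m)"
      using sets by (intro emeasure_mono) (auto simp: small_set_def)
    also have "\<dots> \<le> (\<Sum>m\<in>?I. emeasure \<mu> (small_cover m))"
      using sets by (intro emeasure_subadditive_finite) auto
    finally have "of_nat (4 ^ n) * emeasure \<mu> small_set \<le>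
        of_nat (4 ^ n) * (\<Sum>m\<in>?I. emeasure \<mu> (small_cover m))"
      by (rule mult_left_mono) simp
    also have "\<dots> = (\<Sum>m\<in>?I. of_nat (4 ^ n) * emeasure \<mu> (small_cover m))"
      by (rule sum_distrib_left)
    also have "\<dots> \<le> (\<Sum>m\<in>?I. of_nat (m * m) * emeasure \<mu> (small_cover m))"
    proof (intro sum_mono mult_right_mono of_nat_mono)
      fix m assume "m \<in> ?I"
      then have "2 ^ n * 2 ^ n \<le> m * m" by (intro mult_le_mono) auto
      then show "4 ^ n \<le> m * m" by (simp flip: power_mult_distrib)
    qed simp
    also have "\<dots> \<le> (\<Sum>m\<in>?I. ?M)"
      by (intro sum_mono emeasure_small_cover \<mu>)
    also have "\<dots> = of_nat (2 ^ n) * ?M" by simp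
    finally show ?thesis .
  qed
  show "emeasure \<mu> small_set = 0"
  proof (rule ccontr)
    assume nz: "emeasure \<mu> small_set \<noteq> 0"
    obtain M where M: "?M = ennreal M" "0 \<le> M" using fin by (cases ?M) auto
    have "emeasure \<mu> small_set \<noteq> \<infinity>" using bound[of 0] fin by (auto simp: top_unique)
    then obtain c where c: "emeasure \<mu> small_set = ennreal c" "0 \<le> c" by (cases "emeasure \<mu> small_set") auto
    have "c > 0" using nz c by (auto simp: less_le)
    obtain n where "M / c < 2 ^ n" using real_arch_pow[of 2 "M / c"] by auto
    then have "M < 2 ^ n * c" using \<open>c > 0\<close> by (simp add: pos_divide_less_eq)
    then have "2 ^ n * M < 2 ^ n * (2 ^ n * c)" by simp
    also have "\<dots> = 4 ^ n * c" by (simp flip: mult.assoc power_mult_distrib)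
    finally have "2 ^ n * M < 4 ^ n * c" .
    moreover have "ennreal (4 ^ n * c) \<le> ennreal (2 ^ n * M)"
      using bound[of n] c M by (simp add: ennreal_mult ennreal_power[symmetric])
    ultimately show False using M(2) by simp
  qed
qed

text \<open>
  The shift \<open>\<tau>\<close> plays the role of a limit of partial sums \<open>p m\<close>: it lies in \<open>p m + (A m + A m)\<close> for
  all \<open>m\<close>. The correction \<open>p (Suc m) - p m \<in> A m\<close> is chosen to
  put \<open>s m - p (Suc m)\<close> into the net \<open>Q m\<close>, and the corrections that follow, \<open>\<tau> - p (Suc m)\<close>, amount
  to an element of \<open>A (Suc m) + A (Suc m)\<close>. The first clause of the recursive choice keeps \<open>p m\<close> in \<open>A 0 + A 0\<close>, so that
  \<open>s m - p m\<close> stays in the region covered by \<open>Q m + A m\<close>.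
\<close>

lemma translate_into_covers:
  assumes s: "\<And>m. s m \<in> A 0 + A 0"
  shows "\<exists>\<tau>. \<forall>m x. x - s m \<in> A (Suc m) \<longrightarrow> x - \<tau> \<in> small_cover m"
proof -
  have "\<exists>p. \<forall>m. (\<forall>a\<in>A m. \<forall>b\<in>A m. p m + a + b \<in> A 0 + A 0) \<and>
      (p (Suc m) - p m \<in> A m \<and> s m - p (Suc m) \<in> Q m)"
  proof (rule dependent_nat_choice)
    show "\<exists>p. \<forall>a\<in>A 0. \<forall>b\<in>A 0. p + a + b \<in> A 0 + A 0"
      by (intro exI[of _ 0]) (auto intro: set_plus_intro)
    fix p m
    assume IH: "\<forall>a\<in>A m. \<forall>b\<in>A m. p + a + b \<in> A 0 + A 0"
    then have "p \<in> A 0 + A 0" using zero_mem[of m] by force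
    then obtain u v where uv: "u \<in> A 0" "v \<in> A 0" "p = u + v" by (rule set_plus_elim)
    have "- p \<in> A 0 + A 0"
      using set_plus_intro[OF minus_mem[OF uv(1)] minus_mem[OF uv(2)]] unfolding uv(3) by simp
    then have "s m + - p \<in> Q m + A m"
      using set_plus_intro[OF s] cover_Q by blast
    then obtain q d where qd: "q \<in> Q m" "d \<in> A m" "s m + - p = q + d" by (rule set_plus_elim)
    have "(p + d) + a + b \<in> A 0 + A 0" if "a \<in> A (Suc m)" "b \<in> A (Suc m)" for a b
    proof -
      have "a + b \<in> A m" using plus3_mem[OF that zero_mem] by simp
      then have "p + d + (a + b) \<in> A 0 + A 0" using IH qd(2) by blast
      then show ?thesis by (simp add: add.assoc)
    qed
    moreover have "s m - (p + d) \<in> Q m"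
    proof -
      have "s m - (p + d) = (s m + - p) - d" by (simp add: algebra_simps)
      then show ?thesis using qd(1) unfolding qd(3) by simp
    qed
    ultimately show "\<exists>p'. (\<forall>a\<in>A (Suc m). \<forall>b\<in>A (Suc m). p' + a + b \<in> A 0 + A 0) \<and>
        p' - p \<in> A m \<and> s m - p' \<in> Q m"
      using qd(2) by (intro exI[of _ "p + d"]) auto
  qed
  then obtain p where p: "\<And>m. p (Suc m) - p m \<in> A m" "\<And>m. s m - p (Suc m) \<in> Q m"
    by blast
  \<comment> \<open>The sets \<open>A m\<close> need not shrink to zero, so \<open>p\<close> need not converge; nested compact sets replace
    the limit.\<close>
  define F where "F m = (+) (p m) ` (A m + A m)" for m
  have compF: "compact (F m)" for m
    unfolding F_def
    by (intro compact_translation_group compact_set_plus sym_compact_nbhdD(1)[OF nbhd])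
  have "F (Suc m) \<subseteq> F m" for m
  proof
    fix y assume "y \<in> F (Suc m)"
    then obtain a b where ab: "a \<in> A (Suc m)" "b \<in> A (Suc m)" "y = p (Suc m) + (a + b)"
      unfolding F_def by (auto elim!: set_plus_elim)
    have "a + b \<in> A m" using plus3_mem[OF ab(1,2) zero_mem] by simp
    then have "(p (Suc m) - p m) + (a + b) \<in> A m + A m" by (intro set_plus_intro p(1))
    moreover have "y = p m + ((p (Suc m) - p m) + (a + b))" unfolding ab(3) by simp
    ultimately show "y \<in> F m" unfolding F_def by blast
  qed
  then have antiF: "F n \<subseteq> F m" if "m \<le> n" for m n
    using lift_Suc_antimono_le[of F] that by blast
  have nonempty: "F m \<noteq> {}" for m
    unfolding F_def using set_plus_intro[OF zero_mem zero_mem, of m m] by blast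
  have "F 0 \<inter> \<Inter>(range F) \<noteq> {}"
  proof (rule compact_fip[THEN iffD1, OF compF, rule_format])
    show "closed K" if "K \<in> range F" for K using that compF compact_imp_closed by blast
    fix B assume B: "B \<subseteq> range F" "finite B"
    then obtain N where N: "finite N" "B = F ` N" 
      using finite_subset_image[OF B(2,1)] by auto
    obtain k where "\<And>n. n \<in> N \<Longrightarrow> n \<le> k"
      using finite_nat_set_iff_bounded_le[of N] N(1) by auto
    then have "F k \<subseteq> F 0 \<inter> \<Inter>B" using antiF N(2) by auto
    then show "F 0 \<inter> \<Inter>B \<noteq> {}" using nonempty by blast
  qed
  then obtain \<tau> where \<tau>: "\<And>m. \<tau> \<in> F m" by blast
  have "x - \<tau> \<in> small_cover m" if x: "x - s m \<in> A (Suc m)" for m x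
  proof -
    obtain a b where ab: "a \<in> A (Suc m)" "b \<in> A (Suc m)" "\<tau> = p (Suc m) + (a + b)"
      using \<tau>[of "Suc m"] unfolding F_def by (auto elim!: set_plus_elim)
    have "x - \<tau> = (s m - p (Suc m)) + ((x - s m) + - a + - b)"
      unfolding ab(3) by (simp add: algebra_simps)
    also have "\<dots> \<in> small_cover m"
      unfolding small_cover_def
      by (intro set_plus_intro p(2) x minus_mem ab(1,2))
    finally show ?thesis .
  qed
  then show ?thesis by blast
qed

text \<open>Points of \<open>A 0\<close> are coded, up to \<open>A k\<close>, by the indices of finitely many points of \<open>A 0 + A 0\<close>.\<close>

lemma exists_coding:
  "\<exists>g :: nat \<Rightarrow> 'a. range g \<subseteq> A 0 + A 0 \<and> (\<forall>x\<in>A 0. \<exists>i. x - g i \<in> A k)"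
proof -
  let ?D = "Q k \<inter> (A 0 + A 0)"
  have approx: "\<exists>q\<in>?D. x - q \<in> A k" if x: "x \<in> A 0" for x
  proof -
    have "x + 0 + (0 + 0) \<in> Q k + A k"
      using cover_Q x zero_mem by (intro subsetD[OF cover_Q] set_plus_intro)
    then obtain q a where qa: "q \<in> Q k" "a \<in> A k" "x = q + a" by (auto elim: set_plus_elim)
    have "- a \<in> A 0" using qa(2) minus_mem decreasing[of 0 k] by blast
    then have "x + - a \<in> A 0 + A 0" using x by (intro set_plus_intro)
    moreover have "x + - a = q" unfolding qa(3) by simp
    ultimately have "q \<in> ?D" using qa(1) by simp
    moreover have "x - q \<in> A k" using qa(2) unfolding qa(3) by simp
    ultimately show ?thesis by blast
  qed
  then have ne: "?D \<noteq> {}" using zero_mem by blast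
  have "countable ?D" using finite_Q by (simp add: countable_finite)
  then have "range (from_nat_into ?D) = ?D" by (rule range_from_nat_into[OF ne])
  then show ?thesis using approx
    by (intro exI[of _ "from_nat_into ?D"]) (metis inf_le2 rangeE)
qed

text \<open>
  Each slalom \<open>S\<close> needs only one translate: the sequence \<open>s\<close> to which \<open>translate_into_covers\<close> is
  applied lists the points coded by the elements of \<open>S n\<close> along the \<open>n\<close>-th dyadic block.
\<close>

lemma cover_by_slaloms:
  assumes "capturing_slaloms \<S>"
  shows "\<exists>\<tau> :: (nat \<Rightarrow> nat set) \<Rightarrow> 'a. A 0 \<subseteq> (\<Union>S\<in>\<S>. (+) (\<tau> S) ` small_set)"
proof -
  have \<S>: "\<And>S n. S \<in> \<S> \<Longrightarrow> finite (S n) \<and> card (S n) \<le> 2 ^ n"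
    "\<And>f. \<exists>S\<in>\<S>. \<forall>n. f n \<in> S n"
    using assms unfolding capturing_slaloms_def by simp_all
  obtain g :: "nat \<Rightarrow> nat \<Rightarrow> 'a" where g: "\<And>n i. g n i \<in> A 0 + A 0"
    "\<And>n x. x \<in> A 0 \<Longrightarrow> \<exists>i. x - g n i \<in> A (2 ^ Suc n)"
  proof -
    have "\<exists>g. \<forall>n. range (g n) \<subseteq> A 0 + A 0 \<and> (\<forall>x\<in>A 0. \<exists>i::nat. x - g n i \<in> A (2 ^ Suc n))"
      by (intro choice allI exists_coding)
    then obtain g where g: "\<forall>n. range (g n) \<subseteq> A 0 + A 0 \<and>
        (\<forall>x\<in>A 0. \<exists>i::nat. x - g n i \<in> A (2 ^ Suc n))" by (rule exE)
    show thesis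
    proof (rule that[of g])
      show "g n i \<in> A 0 + A 0" for n i using g by (meson rangeI subsetD)
      show "\<exists>i. x - g n i \<in> A (2 ^ Suc n)" if "x \<in> A 0" for n x using g that by meson
    qed
  qed
  have "\<exists>\<tau>. \<forall>n x. (\<exists>i\<in>S n. x - g n i \<in> A (2 ^ Suc n)) \<longrightarrow>
      x - \<tau> \<in> (\<Union>m\<in>{2 ^ n..<2 ^ Suc n}. small_cover m)" if S: "S \<in> \<S>" for S
  proof -
    have "\<exists>h. S n \<subseteq> h ` {..<2 ^ n :: nat}" for n
    proof -
      obtain h where "bij_betw h {0..<card (S n)} (S n)"
        using \<S>(1)[OF S] ex_bij_betw_nat_finite by blast
      then have "S n = h ` {0..<card (S n)}" by (simp add: bij_betw_def)
      also have "\<dots> \<subseteq> h ` {..<2 ^ n}"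
        using \<S>(1)[OF S, of n] by (intro image_mono) auto
      finally show ?thesis by blast
    qed
    then obtain h where h: "\<And>n. S n \<subseteq> h n ` {..<2 ^ n :: nat}" by metis
    \<comment> \<open>\<open>blk m\<close> is the index of the dyadic block that contains \<open>m\<close> (for positive \<open>m\<close>).\<close>
    define blk where "blk m = (LEAST n. m < 2 ^ Suc n)" for m :: nat
    have blk: "blk (2 ^ n + j) = n" if "j < 2 ^ n" for n j
      unfolding blk_def
    proof (rule Least_equality)
      fix k assume "2 ^ n + j < 2 ^ Suc k"
      then have "(2::nat) ^ n < 2 ^ Suc k" by linarith
      then have "n < Suc k" by (rule power_less_imp_less_exp[rotated]) simp
      then show "n \<le> k" by simp
    qed (use that in simp)
    define s where "s m = g (blk m) (h (blk m) (m - 2 ^ blk m))" for m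
    obtain \<tau> where \<tau>: "\<And>m x. x - s m \<in> A (Suc m) \<Longrightarrow> x - \<tau> \<in> small_cover m"
      using translate_into_covers[of s] g(1) unfolding s_def by blast
    have "x - \<tau> \<in> (\<Union>m\<in>{2 ^ n..<2 ^ Suc n}. small_cover m)"
      if i: "i \<in> S n" "x - g n i \<in> A (2 ^ Suc n)" for n i x
    proof -
      obtain j where j: "j < 2 ^ n" "i = h n j" using h i(1) by blast
      define m where "m = 2 ^ n + j"
      have m: "m \<in> {2 ^ n..<2 ^ Suc n}" unfolding m_def using j(1) by simp
      have "s m = g n i" unfolding s_def m_def blk[OF j(1)] j(2) by simp
      moreover have "A (2 ^ Suc n) \<subseteq> A (Suc m)"
        using m by (intro decreasing) auto
      ultimately have "x - s m \<in> A (Suc m)" using i(2) by auto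
      then show ?thesis using \<tau> m by blast
    qed
    then show ?thesis by blast
  qed
  then obtain \<tau> where \<tau>: "\<And>S n x i. S \<in> \<S> \<Longrightarrow> i \<in> S n \<Longrightarrow> x - g n i \<in> A (2 ^ Suc n) \<Longrightarrow>
      x - \<tau> S \<in> (\<Union>m\<in>{2 ^ n..<2 ^ Suc n}. small_cover m)" by metis
  have "A 0 \<subseteq> (\<Union>S\<in>\<S>. (+) (\<tau> S) ` small_set)"
  proof
    fix x assume "x \<in> A 0"
    then obtain f where f: "\<And>n. x - g n (f n) \<in> A (2 ^ Suc n)" using g(2) by metis
    obtain S where S: "S \<in> \<S>" "\<And>n. f n \<in> S n" using \<S>(2)[of f] by blast
    have "x - \<tau> S \<in> small_set"
      unfolding small_set_def using \<tau>[OF S f] by blast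
    moreover have "x = \<tau> S + (x - \<tau> S)" by simp
    ultimately show "x \<in> (\<Union>S\<in>\<S>. (+) (\<tau> S) ` small_set)" using S(1) by blast
  qed
  then show ?thesis by blast
qed

end

section \<open>Covering the whole group\<close>

lemma countable_ordLeq_cof_null:
  assumes "countable S"
  shows "|S| \<le>o cof_null"
proof -
  obtain \<H> where \<H>: "cofinal_null \<H>" "cof_null = |\<H>|" using cof_null_attained by blast
  have "|S| \<le>o |UNIV :: nat set|"
    using assms card_of_ordLeq[of S "UNIV :: nat set"] unfolding countable_def by blast
  also have "|UNIV :: nat set| \<le>o |\<H>|"
    using infinite_cofinal_null[OF \<H>(1)] infinite_iff_card_of_nat by blast
  finally show ?thesis unfolding \<H>(2) .
qed

lemma UN_ordLeq_cof_null:
  assumes "|I| \<le>o cof_null" "\<And>i. i \<in> I \<Longrightarrow> |S i| \<le>o cof_null"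
  shows "|\<Union>i\<in>I. S i| \<le>o cof_null"
proof -
  obtain \<H> where \<H>: "cofinal_null \<H>" "cof_null = |\<H>|" using cof_null_attained by blast
  show ?thesis
    using assms unfolding \<H>(2)
    by (intro card_of_UNION_ordLeq_infinite infinite_cofinal_null[OF \<H>(1)]) auto
qed

lemma exists_countable_subgroup:
  fixes Q :: "'a::ab_group_add set"
  assumes "countable Q"
  obtains Z where "countable Z" "Q \<subseteq> Z" "add_subgroup Z"
proof -
  let ?L = "lists (Q \<union> uminus ` Q)"
  let ?Z = "sum_list ` ?L"
  have neg: "- sum_list xs = sum_list (map uminus xs)" for xs :: "'a list"
    by (induction xs) simp_all
  have "countable ?Z" using assms by (intro countable_image countable_lists) auto
  moreover have "Q \<subseteq> ?Z"
  proof
    fix q assume "q \<in> Q"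
    then have "[q] \<in> ?L" by simp
    then have "sum_list [q] \<in> ?Z" by (rule imageI)
    then show "q \<in> ?Z" by simp
  qed
  moreover have "add_subgroup ?Z"
    unfolding add_subgroup_def
  proof (intro conjI ballI)
    have "sum_list [] \<in> ?Z" by (intro imageI) simp
    then show "0 \<in> ?Z" by simp
  next
    fix x y assume "x \<in> ?Z" "y \<in> ?Z"
    then obtain xs ys where xy: "xs \<in> ?L" "ys \<in> ?L" "x = sum_list xs" "y = sum_list ys" by blast
    then have "sum_list (xs @ ys) \<in> ?Z" by (intro imageI) simp
    then show "x + y \<in> ?Z" using xy by simp
  next
    fix x assume "x \<in> ?Z"
    then obtain xs where x: "xs \<in> ?L" "x = sum_list xs" by blast
    then have "sum_list (map uminus xs) \<in> ?Z" by (intro imageI) (auto simp: in_lists_conv_set)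
    then show "- x \<in> ?Z" using x neg by simp
  qed
  ultimately show thesis by (rule that)
qed

text \<open>
  If \<open>A + A \<subseteq> Q + A\<close> with \<open>Q\<close> finite and \<open>Z\<close> is a countable subgroup that contains \<open>Q\<close>, then \<open>Z + A\<close> is an
  open subgroup, and each of its cosets is a union of countably many translates of \<open>A\<close>.
\<close>

lemma cover_by_nbhd_translates:
  fixes A :: "'a::{topological_ab_group_add,t2_space} set"
  assumes A: "sym_compact_nbhd A"
    and index: "\<And>H :: 'a set. add_subgroup H \<Longrightarrow> open H \<Longrightarrow> |left_cosets H| \<le>o cof_null"
  shows "\<exists>T. |T| \<le>o cof_null \<and> (\<Union>t\<in>T. (+) t ` A) = UNIV"
proof -
  obtain Q where Q: "finite Q" "A + A \<subseteq> Q + A"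
    using finite_net[OF compact_set_plus[OF sym_compact_nbhdD(1)[OF A] sym_compact_nbhdD(1)[OF A]]
        sym_compact_nbhdD(2)[OF A]]
    by blast
  obtain Z where Z: "countable Z" "Q \<subseteq> Z" "add_subgroup Z"
    using exists_countable_subgroup[OF countable_finite[OF Q(1)]] .
  have Zadd: "x + y \<in> Z" if "x \<in> Z" "y \<in> Z" for x y
    using Z(3) that unfolding add_subgroup_def by blast
  have Z0: "0 \<in> Z" and Zneg: "x \<in> Z \<Longrightarrow> - x \<in> Z" for x
    using Z(3) unfolding add_subgroup_def by blast+
  define H where "H = Z + A"
  have sub: "add_subgroup H"
    unfolding add_subgroup_def
  proof (intro conjI ballI)
    show "0 \<in> H" unfolding H_def using set_plus_intro[OF Z0 sym_compact_nbhdD(4)[OF A]] by simp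
  next
    fix x y assume "x \<in> H" "y \<in> H"
    then obtain z a z' a' where *: "z \<in> Z" "a \<in> A" "x = z + a" "z' \<in> Z" "a' \<in> A" "y = z' + a'"
      unfolding H_def by (auto elim!: set_plus_elim)
    obtain q b where qb: "q \<in> Q" "b \<in> A" "a + a' = q + b"
      using Q(2) set_plus_intro[OF *(2,5)] by (meson set_plus_elim subsetD)
    have "x + y = z + z' + (a + a')" using * by (simp add: algebra_simps)
    also have "\<dots> = (z + z' + q) + b" unfolding qb(3) by (simp add: algebra_simps)
    also have "\<dots> \<in> H" unfolding H_def using * qb Z(2) by (intro set_plus_intro Zadd) auto
    finally show "x + y \<in> H" .
  next
    fix x assume "x \<in> H"
    then obtain z a where *: "z \<in> Z" "a \<in> A" "x = z + a" unfolding H_def by (rule set_plus_elim)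
    have "- z + - a \<in> H" unfolding H_def
      by (intro set_plus_intro Zneg *(1) sym_compact_nbhdD(3)[OF A *(2)])
    then show "- x \<in> H" using *(3) by simp
  qed
  have "open H"
  proof -
    have "H = (\<Union>h\<in>H. (+) h ` interior A)"
    proof (intro equalityI subsetI)
      fix x assume "x \<in> H"
      moreover have "x \<in> (+) x ` interior A" using sym_compact_nbhdD(2)[OF A] by force
      ultimately show "x \<in> (\<Union>h\<in>H. (+) h ` interior A)" by blast
    next
      fix x assume "x \<in> (\<Union>h\<in>H. (+) h ` interior A)"
      then obtain h a where ha: "h \<in> H" "a \<in> A" "x = h + a" using interior_subset[of A] by blast
      have "0 + a \<in> H" unfolding H_def by (intro set_plus_intro Z0 ha(2))
      then show "x \<in> H" using sub ha unfolding add_subgroup_def by simp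
    qed
    also have "open \<dots>" by (intro open_UN ballI open_translation_group open_interior)
    finally show ?thesis .
  qed
  then have idx: "|left_cosets H| \<le>o cof_null" by (rule index[OF sub])
  have "\<exists>r. \<forall>c\<in>left_cosets H. c = (+) (r c) ` H"
    unfolding left_cosets_def by (intro bchoice) auto
  then obtain r where r: "\<forall>c\<in>left_cosets H. c = (+) (r c) ` H" by (rule exE)
  define T where "T = (\<Union>c\<in>left_cosets H. (+) (r c) ` Z)"
  have "|T| \<le>o cof_null" unfolding T_def
    by (intro UN_ordLeq_cof_null idx countable_ordLeq_cof_null countable_image Z(1))
  moreover have "x \<in> (\<Union>t\<in>T. (+) t ` A)" for x
  proof -
    have c: "(+) x ` H \<in> left_cosets H" (is "?c \<in> _") unfolding left_cosets_def by simp
    have "x + 0 \<in> (+) x ` H" using sub unfolding add_subgroup_def by blast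
    then have "x + 0 \<in> (+) (r ?c) ` H" by (subst bspec[OF r c, symmetric])
    then obtain z a where za: "z \<in> Z" "a \<in> A" "x + 0 = r ?c + (z + a)"
      unfolding H_def by (auto elim!: set_plus_elim)
    have "r ?c + z \<in> T" unfolding T_def using c za(1) by blast
    moreover have "x = (r ?c + z) + a" using za(3) by (simp add: add.assoc)
    ultimately show ?thesis using za(2) by blast
  qed
  ultimately show ?thesis by blast
qed

theorem theorem2p3:
  assumes "locally_compact_space (euclidean :: 'a::{topological_ab_group_add,t2_space} topology)"
    and "(euclidean :: 'a topology) \<noteq> discrete_topology UNIV"
    and "\<And>H :: 'a set. add_subgroup H \<Longrightarrow> open H \<Longrightarrow> |left_cosets H| \<le>o cof_null"
  shows "nice_group TYPE('a)"
proof -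
  obtain A :: "nat \<Rightarrow> 'a set" and Q where "scale_sequence A Q"
    using exists_scale_sequence[OF assms(1,2)] by blast
  then interpret scale_sequence A Q .
  obtain \<S> where \<S>: "|\<S>| \<le>o cof_null" "capturing_slaloms \<S>"
    by (rule cof_null_slaloms)
  obtain \<tau> :: "(nat \<Rightarrow> nat set) \<Rightarrow> 'a" where \<tau>: "A 0 \<subseteq> (\<Union>S\<in>\<S>. (+) (\<tau> S) ` small_set)"
    using cover_by_slaloms[OF \<S>(2)] by blast
  obtain T where T: "|T| \<le>o cof_null" "(\<Union>t\<in>T. (+) t ` A 0) = UNIV"
    using cover_by_nbhd_translates[OF nbhd assms(3)] by blast
  let ?B = "\<Union>t\<in>T. (\<lambda>S. t + \<tau> S) ` \<S>"
  have "|?B| \<le>o cof_null"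
    using T(1) \<S>(1) card_of_image ordLeq_transitive by (intro UN_ordLeq_cof_null) blast+
  moreover have "x \<in> (\<Union>b\<in>?B. (+) b ` small_set)" for x
  proof -
    have "x \<in> (\<Union>t\<in>T. (+) t ` A 0)" using T(2) by simp
    then obtain t y where t: "t \<in> T" "y \<in> A 0" "x = t + y" by blast
    obtain S c where S: "S \<in> \<S>" "c \<in> small_set" "y = \<tau> S + c" using \<tau> t(2) by blast
    have "x = (t + \<tau> S) + c" unfolding t(3) S(3) by (simp add: add.assoc)
    then show ?thesis using t(1) S(1,2) by blast
  qed
  then have "(\<Union>b\<in>?B. (+) b ` small_set) = UNIV" by blast
  ultimately show ?thesis
    unfolding nice_group_def
    using assms(1) compact_small_set haar_null_small_set by blast
qed

end
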